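(* Let $S$ be a finite set, let $P$ be an irreducible stochastic matrix on $S$, and let $f:S\to\mathbb{R}$. Put $a:=\min_{x} f(x)$, $b:=\max_{x} f(x)$, $S_a:=\{x\in S:f(x)=a\}$, $S_b:=\{x\in S: f(x)=b\}$. Assume that the submatrix of $P$ with rows and columns in $S_b$ is irreducible; that for every $x\in S\setminus S_b$ there exists $y\in S_b$ with $P(x,y)>0$; that the submatrix of $P$ with rows and columns in $S_a$ is irreducible; and that for every $x\in S\setminus S_a$ there exists $y\in S_a$ with $P(x,y)>0$. Let $q$ be any initial distribution on $S$ and, for $n\ge 1$, let $$\Lambda_n(\theta):=\frac1n\log\mathbb{E}_q\left[\exp\left\{\theta\sum_{k=1}^n f(X_k)\right\}\right].$$ Then for every $n\ge1$ $$\sup_{\theta\in\mathbb{R}}|\Lambda_n(\theta)-\Lambda(\theta)|\le\frac{\log K}{n},$$ where $K=\max\{K_u(P,f),K_u(P,-f)\}$ is a finite constant. Therefore $\Lambda_n(\theta)$ converges uniformly on $\mathbb{R}$ to $\Lambda(\theta)$ as $n\to\infty$.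
   Context: A square nonnegative matrix $A$ is irreducible if for all indices $x,y$ there is $n\ge1$ with $A^n(x,y)>0$ (in particular the $1\times1$ zero matrix is not irreducible). $\mathbb{E}_q$ is expectation under the law of the Markov chain $(X_k)_{k\ge0}$ on $S$ with $X_0\sim q$ and transition probability matrix $P$. For $\theta\in\mathbb{R}$ let $\tilde P_\theta(x,y):=P(x,y)e^{\theta f(y)}$, which is nonnegative and irreducible; let $\rho(\theta)$ be its spectral radius (Perron-Frobenius eigenvalue), and let $u_\theta,v_\theta$ be the unique entrywise positive left and right eigenvectors of $\tilde P_\theta$ for the eigenvalue $\rho(\theta)$ with $\sum_x u_\theta(x)=1$ and $\sum_x u_\theta(x)v_\theta(x)=1$. $\Lambda(\theta):=\log\rho(\theta)$. $K_u(P,f):=\sup_{\theta\ge0,\;x,y\in S}\frac{v_\theta(x)}{v_\theta(y)}$, and $K_u(P,-f)$ is the same quantity with $f$ replaced by $-f$ throughout. *)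

theory Defs
  imports "HOL-Probability.Probability"
begin

definition stochastic :: "real ^ 's ^ 's \<Rightarrow> bool" where
  "stochastic P \<longleftrightarrow> (\<forall>x y. 0 \<le> P $ x $ y) \<and> (\<forall>x. (\<Sum>y\<in>UNIV. P $ x $ y) = 1)"

(* The entries, for x and y in T, of the n-th power of the submatrix of A with rows and
   columns in T: intermediate indices are summed over T only. *)
primrec submatrix_power :: "'s set \<Rightarrow> real ^ 's ^ 's \<Rightarrow> nat \<Rightarrow> 's \<Rightarrow> 's \<Rightarrow> real" where
  "submatrix_power T A 0 x y = (if x = y then 1 else 0)"
| "submatrix_power T A (Suc n) x y = (\<Sum>z\<in>T. A $ x $ z * submatrix_power T A n z y)"

(* For T = UNIV this is irreducibility of A itself. Only applied to matrices that are
   nonnegative; because of n \<ge> 1, a 1-by-1 zero submatrix is not irreducible. *)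
definition irreducible_on :: "'s set \<Rightarrow> real ^ 's ^ 's \<Rightarrow> bool" where
  "irreducible_on T A \<longleftrightarrow> (\<forall>x\<in>T. \<forall>y\<in>T. \<exists>n\<ge>1. submatrix_power T A n x y > 0)"

definition spectral_radius :: "real ^ 's ^ 's \<Rightarrow> real" where
  "spectral_radius A = Sup {cmod l |l. \<exists>w. w \<noteq> 0 \<and> map_matrix complex_of_real A *v w = l *s w}"

definition tilted :: "real ^ 's ^ 's \<Rightarrow> ('s \<Rightarrow> real) \<Rightarrow> real \<Rightarrow> real ^ 's ^ 's" where
  "tilted P f \<theta> = (\<chi> x y. P $ x $ y * exp (\<theta> * f y))"

(* The two definite descriptions are meaningful for irreducible nonnegative matrices, where
   existence and uniqueness are the Perron-Frobenius theorem. *)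
definition perron_left :: "real ^ 's ^ 's \<Rightarrow> real ^ 's" where
  "perron_left A = (THE u. (\<forall>x. 0 < u $ x) \<and> u v* A = spectral_radius A *\<^sub>R u \<and>
     (\<Sum>x\<in>UNIV. u $ x) = 1)"

definition perron_right :: "real ^ 's ^ 's \<Rightarrow> real ^ 's" where
  "perron_right A = (THE v. (\<forall>x. 0 < v $ x) \<and> A *v v = spectral_radius A *\<^sub>R v \<and>
     (\<Sum>x\<in>UNIV. perron_left A $ x * v $ x) = 1)"

definition log_spectral_radius :: "real ^ 's ^ 's \<Rightarrow> ('s \<Rightarrow> real) \<Rightarrow> real \<Rightarrow> real" where
  "log_spectral_radius P f \<theta> = ln (spectral_radius (tilted P f \<theta>))"

(* Extended-real valued, so that finiteness is a genuine assertion about the supremum. *)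
definition K_u :: "real ^ 's ^ 's \<Rightarrow> ('s \<Rightarrow> real) \<Rightarrow> ereal" where
  "K_u P f = (SUP \<theta>\<in>{0..}. SUP x. SUP y.
     ereal (perron_right (tilted P f \<theta>) $ x / perron_right (tilted P f \<theta>) $ y))"

locale markov_chain = prob_space M
  for M :: "'w measure" and q :: "'s::finite pmf" and P :: "real ^ 's ^ 's"
    and X :: "nat \<Rightarrow> 'w \<Rightarrow> 's" +
  assumes measurable_X: "\<And>k. X k \<in> measurable M (count_space UNIV)"
    and initial: "distr M (count_space UNIV) (X 0) = measure_pmf q"
    and transition: "\<And>n h y. \<P>(\<omega> in M. \<forall>i\<le>n. X i \<omega> = h i) > 0 \<Longrightarrow>
      \<P>(\<omega> in M. X (Suc n) \<omega> = y \<bar> \<forall>i\<le>n. X i \<omega> = h i) = P $ h n $ y"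

(* M and X realise the chain; the value depends only on the law of X. *)
definition scaled_cgf ::
    "'w measure \<Rightarrow> (nat \<Rightarrow> 'w \<Rightarrow> 's) \<Rightarrow> ('s \<Rightarrow> real) \<Rightarrow> nat \<Rightarrow> real \<Rightarrow> real" where
  "scaled_cgf M X f n \<theta> =
     1 / real n * ln (prob_space.expectation M (\<lambda>\<omega>. exp (\<theta> * (\<Sum>k=1..n. f (X k \<omega>)))))"

end

theory Submission
  imports Defs
begin

text \<open>
  If \<open>v\<close> is a positive eigenvector of the tilted matrix for \<open>r\<close>, then
  \<open>exp (\<theta> * (f (X 1) + \<dots> + f (X n))) * v (X n) / r ^ n\<close> is a martingale; hence the
  moment generating function equals \<open>r ^ n\<close> up to a factor bounded by the oscillation of
  \<open>v\<close>. This oscillation is bounded uniformly in \<open>\<theta> \<ge> 0\<close>: after normalising the maximum of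
  \<open>f\<close> to 0, the entries with columns in \<open>Sb\<close> do not depend on \<open>\<theta>\<close>, which keeps \<open>r\<close> away
  from 0 and bounds \<open>v\<close> from below by its values on \<open>Sb\<close>; for large \<open>\<theta>\<close> the remaining
  columns are negligible, so the maximum of \<open>v\<close> is also controlled by \<open>Sb\<close>, while for
  \<open>\<theta>\<close> in a bounded interval the irreducibility of \<open>P\<close> suffices. Negative \<open>\<theta>\<close> are
  reduced to positive ones by passing to \<open>- f\<close>.
\<close>

section \<open>Powers of submatrices\<close>

text \<open>Carries bounds for \<open>P\<close> over to the tilted matrix: with \<open>c = 1\<close>
  on the maximising set, and with a lower bound \<open>c\<close> of the weights on all states. Every
  factor along a path inside \<open>T\<close> has its column in \<open>T\<close>, so only those
  columns are compared; nonnegativity is carried along because multiplying inequalities requires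
  it.\<close>

lemma submatrix_power_mono:
  fixes A B :: "real ^ 's::finite ^ 's"
  assumes "0 \<le> c" and "\<And>x y. 0 \<le> B $ x $ y"
    and "\<And>x y. y \<in> T \<Longrightarrow> c * B $ x $ y \<le> A $ x $ y"
  shows "0 \<le> submatrix_power T B n x y \<and>
    c ^ n * submatrix_power T B n x y \<le> submatrix_power T A n x y"
proof (induction n arbitrary: x)
  case (Suc n)
  have "c ^ Suc n * submatrix_power T B (Suc n) x y =
      (\<Sum>z\<in>T. (c * B $ x $ z) * (c ^ n * submatrix_power T B n z y))"
    by (simp add: sum_distrib_left mult_ac)
  also have "\<dots> \<le> (\<Sum>z\<in>T. A $ x $ z * submatrix_power T A n z y)"
  proof (rule sum_mono)
    fix z assume "z \<in> T"
    then show "(c * B $ x $ z) * (c ^ n * submatrix_power T B n z y)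
        \<le> A $ x $ z * submatrix_power T A n z y"
      using Suc.IH[of z] assms order_trans[OF _ assms(3)]
      by (intro mult_mono) auto
  qed
  finally show ?case
    using Suc.IH assms(2) by (auto intro!: sum_nonneg)
qed simp

lemma submatrix_power_Suc_right:
  fixes A :: "real ^ 's::finite ^ 's"
  assumes "x \<in> T" "y \<in> T"
  shows "submatrix_power T A (Suc n) x y = (\<Sum>z\<in>T. submatrix_power T A n x z * A $ z $ y)"
  using assms(1)
proof (induction n arbitrary: x)
  case 0
  have "(\<Sum>z\<in>T. A $ x $ z * (if z = y then 1 else 0)) = A $ x $ y"
    using assms(2) by (simp add: if_distrib[where f = "(*) _"] cong: if_cong)
  moreover have "(\<Sum>z\<in>T. (if x = z then 1 else 0) * A $ z $ y) = A $ x $ y"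
    using 0 by (simp add: if_distrib[where f = "\<lambda>a. a * _"] cong: if_cong)
  ultimately show ?case by simp
next
  case (Suc n)
  have "submatrix_power T A (Suc (Suc n)) x y =
      (\<Sum>w\<in>T. A $ x $ w * (\<Sum>z\<in>T. submatrix_power T A n w z * A $ z $ y))"
    using Suc.IH by simp
  also have "\<dots> = (\<Sum>w\<in>T. \<Sum>z\<in>T. A $ x $ w * submatrix_power T A n w z * A $ z $ y)"
    by (simp add: sum_distrib_left mult_ac)
  also have "\<dots> = (\<Sum>z\<in>T. \<Sum>w\<in>T. A $ x $ w * submatrix_power T A n w z * A $ z $ y)"
    by (rule sum.swap)
  finally show ?case by (simp add: sum_distrib_right)
qed

lemma submatrix_power_transpose:
  fixes A :: "real ^ 's::finite ^ 's"
  assumes "x \<in> T" "y \<in> T"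
  shows "submatrix_power T (transpose A) n x y = submatrix_power T A n y x"
  using assms
proof (induction n arbitrary: x)
  case (Suc n)
  have "submatrix_power T (transpose A) (Suc n) x y =
      (\<Sum>z\<in>T. submatrix_power T A n y z * A $ z $ x)"
    using Suc by (simp add: transpose_def mult_ac)
  then show ?case
    using submatrix_power_Suc_right[of y T x A n] Suc.prems by simp
qed auto

lemma irreducible_on_transpose:
  fixes A :: "real ^ 's::finite ^ 's"
  shows "irreducible_on T A \<Longrightarrow> irreducible_on T (transpose A)"
  unfolding irreducible_on_def by (simp add: submatrix_power_transpose)

text \<open>Iterating \<open>A v \<le> r v\<close> gives \<open>A^n v \<le> r^n v\<close>; paths
  that leave \<open>T\<close> or end away from \<open>y\<close> contribute nonnegative terms and are
  dropped. A lower bound on one path thus compares two entries of \<open>v\<close>.\<close>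

lemma submatrix_power_le_of_supereigenvector:
  fixes A :: "real ^ 's::finite ^ 's"
  assumes nonneg: "\<And>x y. 0 \<le> A $ x $ y" and v: "\<And>x. 0 \<le> v $ x" and "0 \<le> r"
    and sup: "\<And>x. (A *v v) $ x \<le> r * v $ x" and "y \<in> T"
  shows "submatrix_power T A n x y * v $ y \<le> r ^ n * v $ x"
proof (induction n arbitrary: x)
  case (Suc n)
  have "submatrix_power T A (Suc n) x y * v $ y =
      (\<Sum>z\<in>T. A $ x $ z * (submatrix_power T A n z y * v $ y))"
    by (simp add: sum_distrib_right mult.assoc)
  also have "\<dots> \<le> (\<Sum>z\<in>T. A $ x $ z * (r ^ n * v $ z))"
    by (intro sum_mono mult_left_mono Suc.IH nonneg)
  also have "\<dots> \<le> (\<Sum>z\<in>UNIV. A $ x $ z * (r ^ n * v $ z))"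
    using nonneg v \<open>0 \<le> r\<close> by (intro sum_mono2) auto
  also have "\<dots> = r ^ n * (A *v v) $ x"
    by (simp add: matrix_vector_mult_def sum_distrib_left mult_ac)
  also have "\<dots> \<le> r ^ n * (r * v $ x)"
    using \<open>0 \<le> r\<close> by (intro mult_left_mono sup) auto
  finally show ?case by (simp add: mult_ac)
qed (use v in auto)

section \<open>Perron--Frobenius theory\<close>

text \<open>Brouwer's theorem on the probability simplex, for the map sending \<open>v\<close> to
  the normalised \<open>v + A v\<close>. Adding \<open>v\<close> keeps the normalising constant at
  least 1 even if \<open>A v = 0\<close>; at a fixed point,
  \<open>A v = (N v - 1) v\<close>.\<close>

lemma nonneg_matrix_eigenvector:
  fixes A :: "real ^ 's::finite ^ 's"
  assumes nonneg: "\<And>x y. 0 \<le> A $ x $ y"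
  obtains v r where "\<And>x. 0 \<le> v $ x" "v \<noteq> 0" "0 \<le> r" "A *v v = r *\<^sub>R v"
proof -
  let ?D = "{v :: real ^ 's. (\<forall>x. 0 \<le> v $ x) \<and> (\<Sum>x\<in>UNIV. v $ x) = 1}"
  define N where "N v = 1 + (\<Sum>x\<in>UNIV. (A *v v) $ x)" for v
  define F where "F v = (1 / N v) *\<^sub>R (v + A *v v)" for v
  have Av: "0 \<le> (A *v v) $ x" if "v \<in> ?D" for v x
    using that nonneg by (auto simp: matrix_vector_mult_def intro!: sum_nonneg)
  have N: "1 \<le> N v" if "v \<in> ?D" for v
    using Av[OF that] by (auto simp: N_def intro!: sum_nonneg)
  have "closed ?D"
    by (intro closed_Collect_conj closed_Collect_all closed_Collect_le closed_Collect_eq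
        continuous_intros)
  moreover have "bounded ?D"
  proof (rule boundedI)
    fix v assume "v \<in> ?D"
    then show "norm v \<le> 1" using norm_le_l1_cart[of v] by simp
  qed
  ultimately have "compact ?D" by (simp add: compact_eq_bounded_closed)
  moreover have "convex ?D"
    by (auto simp: convex_def sum.distrib sum_distrib_left[symmetric])
  moreover have "?D \<noteq> {}"
  proof -
    have "(\<chi> x. 1 / real CARD('s)) \<in> ?D" by simp
    then show ?thesis by blast
  qed
  moreover have "continuous_on ?D F"
    unfolding F_def N_def
  proof (intro continuous_intros ballI)
    fix v assume "v \<in> ?D"
    then show "1 + (\<Sum>x\<in>UNIV. (A *v v) $ x) \<noteq> 0" using N by (force simp: N_def)
  qed
  moreover have "F \<in> ?D \<rightarrow> ?D"
  proof
    fix v assume v: "v \<in> ?D"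
    have "(\<Sum>x\<in>UNIV. F v $ x) = 1 / N v * (\<Sum>x\<in>UNIV. v $ x + (A *v v) $ x)"
      by (simp add: F_def sum_distrib_left)
    also have "\<dots> = 1" using v N[OF v] by (simp add: sum.distrib N_def)
    finally show "F v \<in> ?D" using v Av[OF v] N[OF v] by (simp add: F_def)
  qed
  ultimately obtain v where v: "v \<in> ?D" "F v = v" using brouwer by blast
  have "N v *\<^sub>R v = N v *\<^sub>R F v" using v by simp
  also have "\<dots> = v + A *v v" using N[OF v(1)] by (simp add: F_def)
  finally have "A *v v = (N v - 1) *\<^sub>R v" by (simp add: scaleR_left_diff_distrib)
  moreover have "v \<noteq> 0" using v(1) by auto
  ultimately show ?thesis using that[of v "N v - 1"] v(1) N[OF v(1)] by simp
qed

text \<open>A nonzero nonnegative vector has a positive entry, and positivity spreads from it to any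
  \<open>x\<close> along a path from \<open>x\<close> to it.\<close>

lemma irreducible_eigenvector_pos:
  fixes A :: "real ^ 's::finite ^ 's"
  assumes nonneg: "\<And>x y. 0 \<le> A $ x $ y" and irr: "irreducible_on UNIV A"
    and v: "\<And>x. 0 \<le> v $ x" "v \<noteq> 0" and "0 \<le> r" "A *v v = r *\<^sub>R v"
  shows "0 < v $ x" and "0 < r"
proof -
  obtain y where "v $ y \<noteq> 0" using v(2) by (auto simp: vec_eq_iff)
  with v(1)[of y] have y: "0 < v $ y" by simp
  obtain n where n: "n \<ge> 1" "0 < submatrix_power UNIV A n x y"
    using irr by (auto simp: irreducible_on_def)
  have "0 < submatrix_power UNIV A n x y * v $ y" using n y by simp
  also have "\<dots> \<le> r ^ n * v $ x"
    using assms by (intro submatrix_power_le_of_supereigenvector) auto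
  finally have *: "0 < r ^ n * v $ x" .
  then show "0 < v $ x" using v(1)[of x] by (cases "v $ x = 0") auto
  \<comment> \<open>Here \<open>n \<ge> 1\<close> matters: it makes \<open>r ^ n\<close> vanish at
    \<open>r = 0\<close>.\<close>
  show "0 < r" using * n(1) \<open>0 \<le> r\<close> by (cases "r = 0") (auto simp: power_0_left)
qed

lemma irreducible_positive_eigenvector:
  fixes A :: "real ^ 's::finite ^ 's"
  assumes "\<And>x y. 0 \<le> A $ x $ y" "irreducible_on UNIV A"
  obtains v r where "\<And>x. 0 < v $ x" "0 < r" "A *v v = r *\<^sub>R v"
  using nonneg_matrix_eigenvector[of A] irreducible_eigenvector_pos[of A] assms by metis

text \<open>Evaluating \<open>u A v\<close> from either side gives \<open>s\<close> and
  \<open>r\<close> times the same positive number \<open>u \<bullet> v\<close>.\<close>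

lemma left_right_eigenvalue_eq:
  fixes A :: "real ^ 's::finite ^ 's"
  assumes u: "\<And>x. 0 < u $ x" "u v* A = s *\<^sub>R u"
    and v: "\<And>x. 0 < v $ x" "A *v v = r *\<^sub>R v"
  shows "s = r"
proof -
  have "s * (u \<bullet> v) = (u v* A) \<bullet> v" using u by simp
  also have "\<dots> = u \<bullet> (A *v v)" by (rule dot_lmul_matrix)
  also have "\<dots> = r * (u \<bullet> v)" using v by simp
  finally have "s * (u \<bullet> v) = r * (u \<bullet> v)" .
  moreover have "0 < u \<bullet> v"
    using u(1) v(1) by (auto simp: inner_vec_def intro!: sum_pos)
  ultimately show ?thesis by simp
qed

text \<open>The value \<open>r\<close> is attained by \<open>v\<close> read as a complex vector. For
  any complex eigenvector, taking absolute values entrywise gives \<open>m z \<le> A z\<close>, and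
  pairing with the positive left eigenvector \<open>u\<close> turns this into
  \<open>m \<le> r\<close>.\<close>

lemma spectral_radius_eq:
  fixes A :: "real ^ 's::finite ^ 's"
  assumes nonneg: "\<And>x y. 0 \<le> A $ x $ y"
    and u: "\<And>x. 0 < u $ x" "u v* A = r *\<^sub>R u"
    and v: "\<And>x. 0 < v $ x" "A *v v = r *\<^sub>R v" and "0 < r"
  shows "spectral_radius A = r"
  unfolding spectral_radius_def
proof (rule cSup_eq_maximum)
  let ?w = "\<chi> x. complex_of_real (v $ x)"
  have "map_matrix complex_of_real A *v ?w = complex_of_real r *s ?w"
  proof (simp add: vec_eq_iff, rule allI)
    fix x
    have "(map_matrix complex_of_real A *v ?w) $ x = complex_of_real ((A *v v) $ x)"
      by (simp add: matrix_vector_mult_def map_matrix_def)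
    then show "(map_matrix complex_of_real A *v ?w) $ x = complex_of_real r * complex_of_real (v $ x)"
      by (simp add: v(2))
  qed
  moreover have "?w \<noteq> 0" using v(1) by (auto simp: vec_eq_iff less_le)
  moreover have "r = cmod (complex_of_real r)" using \<open>0 < r\<close> by simp
  ultimately show "r \<in> {cmod l |l. \<exists>w. w \<noteq> 0 \<and> map_matrix complex_of_real A *v w = l *s w}"
    by blast
next
  fix m assume "m \<in> {cmod l |l. \<exists>w. w \<noteq> 0 \<and> map_matrix complex_of_real A *v w = l *s w}"
  then obtain l w where m: "m = cmod l" and w: "w \<noteq> 0" "map_matrix complex_of_real A *v w = l *s w"
    by blast
  define z where "z = (\<chi> x. cmod (w $ x))"
  have le: "m * z $ x \<le> (A *v z) $ x" for x
  proof -
    have "m * z $ x = cmod ((map_matrix complex_of_real A *v w) $ x)"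
      by (simp add: w m z_def norm_mult)
    also have "\<dots> \<le> (\<Sum>y\<in>UNIV. cmod (complex_of_real (A $ x $ y) * w $ y))"
      by (simp add: matrix_vector_mult_def map_matrix_def norm_sum)
    also have "\<dots> = (A *v z) $ x"
      by (simp add: matrix_vector_mult_def z_def norm_mult nonneg)
    finally show ?thesis .
  qed
  have "m * (u \<bullet> z) = (\<Sum>x\<in>UNIV. u $ x * (m * z $ x))"
    by (simp add: inner_vec_def sum_distrib_left mult_ac)
  also have "\<dots> \<le> u \<bullet> (A *v z)"
    unfolding inner_vec_def inner_real_def
    using u(1) le by (intro sum_mono mult_left_mono) (auto simp: less_imp_le)
  also have "\<dots> = r * (u \<bullet> z)" using u(2) by (simp add: dot_lmul_matrix[symmetric])
  finally have "m * (u \<bullet> z) \<le> r * (u \<bullet> z)" .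
  moreover have "0 < u \<bullet> z"
  proof -
    obtain x where "w $ x \<noteq> 0" using w(1) by (auto simp: vec_eq_iff)
    then have "0 < u $ x * z $ x" using u(1) by (simp add: z_def)
    also have "\<dots> \<le> u \<bullet> z"
      unfolding inner_vec_def inner_real_def
      using u(1) by (intro member_le_sum) (auto simp: z_def less_imp_le)
    finally show ?thesis .
  qed
  ultimately show "m \<le> r" by simp
qed

text \<open>Subtract from \<open>w\<close> the largest multiple of \<open>v\<close> that stays below
  it: the difference is a nonnegative eigenvector with a zero entry, hence zero by
  irreducibility.\<close>

lemma irreducible_eigenvector_unique:
  fixes A :: "real ^ 's::finite ^ 's"
  assumes nonneg: "\<And>x y. 0 \<le> A $ x $ y" and irr: "irreducible_on UNIV A"
    and v: "\<And>x. 0 < v $ x" "A *v v = r *\<^sub>R v"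
    and w: "\<And>x. 0 < w $ x" "A *v w = r *\<^sub>R w" and "0 < r"
  obtains t where "w = t *\<^sub>R v"
proof -
  define t where "t = Min (range (\<lambda>x. w $ x / v $ x))"
  let ?d = "w - t *\<^sub>R v"
  have "t \<in> range (\<lambda>x. w $ x / v $ x)" unfolding t_def by (rule Min_in) auto
  then obtain x0 where "t = w $ x0 / v $ x0" by blast
  then have zero: "?d $ x0 = 0" using v(1)[of x0] by simp
  have d: "0 \<le> ?d $ x" for x
  proof -
    have "t \<le> w $ x / v $ x" unfolding t_def by (rule Min_le) auto
    then show ?thesis using v(1)[of x] by (simp add: field_simps)
  qed
  have "A *v ?d = r *\<^sub>R ?d"
    by (simp add: matrix_vector_mult_diff_distrib matrix_vector_mult_scaleR v w
        scaleR_right_diff_distrib)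
  then have "?d = 0"
    using irreducible_eigenvector_pos(1)[of A ?d r x0] nonneg irr d zero \<open>0 < r\<close> by fastforce
  then show ?thesis using that[of t] by simp
qed

text \<open>Resolves the two definite descriptions. Existence comes from positive eigenvectors of
  \<open>A\<close> and of its transpose, rescaled; uniqueness holds because eigenvectors are
  proportional and the normalisation fixes the factor.\<close>

lemma perron_right_eigenvector:
  fixes A :: "real ^ 's::finite ^ 's"
  assumes nonneg: "\<And>x y. 0 \<le> A $ x $ y" and irr: "irreducible_on UNIV A"
  shows "0 < spectral_radius A" "0 < perron_right A $ x"
    "A *v perron_right A = spectral_radius A *\<^sub>R perron_right A"
proof -
  let ?r = "spectral_radius A"
  have nonneg': "0 \<le> transpose A $ x $ y" for x y using nonneg by (simp add: transpose_def)
  have irr': "irreducible_on UNIV (transpose A)" using irr by (rule irreducible_on_transpose)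
  obtain v0 r where v0: "\<And>x. 0 < v0 $ x" "0 < r" "A *v v0 = r *\<^sub>R v0"
    using irreducible_positive_eigenvector[OF nonneg irr] by blast
  obtain u0 s where u0: "\<And>x. 0 < u0 $ x" "0 < s" "transpose A *v u0 = s *\<^sub>R u0"
    using irreducible_positive_eigenvector[OF nonneg' irr'] by blast
  have "u0 v* A = s *\<^sub>R u0" using u0(3) by simp
  moreover from this have "s = r" using left_right_eigenvalue_eq u0(1) v0 by blast
  ultimately have ur: "u0 v* A = r *\<^sub>R u0" by simp
  have r: "?r = r" using spectral_radius_eq[OF nonneg] u0(1) ur v0 by blast
  show "0 < ?r" using r v0 by simp
  define c where "c = (\<Sum>x\<in>UNIV. u0 $ x)"
  have c: "0 < c" unfolding c_def using u0(1) by (intro sum_pos) auto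
  define u where "u = (1 / c) *\<^sub>R u0"
  have u: "\<And>x. 0 < u $ x" "u v* A = ?r *\<^sub>R u" "(\<Sum>x\<in>UNIV. u $ x) = 1"
    using u0(1) c ur r
    by (auto simp: u_def c_def sum_divide_distrib[symmetric] matrix_vector_mult_scaleR
        simp flip: transpose_matrix_vector)
  have "perron_left A = u"
    unfolding perron_left_def
  proof (rule the_equality)
    fix w assume w: "(\<forall>x. 0 < w $ x) \<and> w v* A = ?r *\<^sub>R w \<and> (\<Sum>x\<in>UNIV. w $ x) = 1"
    obtain t where t: "w = t *\<^sub>R u"
      using irreducible_eigenvector_unique[OF nonneg' irr', of u ?r w] u w \<open>0 < ?r\<close> by auto
    have "t = (\<Sum>x\<in>UNIV. w $ x)" using u(3) by (simp add: t sum_distrib_left[symmetric])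
    then show "w = u" using w t by simp
  qed (use u in auto)
  define d where "d = (\<Sum>x\<in>UNIV. u $ x * v0 $ x)"
  have d: "0 < d" unfolding d_def using u(1) v0(1) by (intro sum_pos) auto
  define v where "v = (1 / d) *\<^sub>R v0"
  have v: "\<And>x. 0 < v $ x" "A *v v = ?r *\<^sub>R v" "(\<Sum>x\<in>UNIV. u $ x * v $ x) = 1"
    using v0 d r
    by (auto simp: v_def d_def matrix_vector_mult_scaleR sum_divide_distrib[symmetric])
  have "perron_right A = v"
    unfolding perron_right_def \<open>perron_left A = u\<close>
  proof (rule the_equality)
    fix w assume w: "(\<forall>x. 0 < w $ x) \<and> A *v w = ?r *\<^sub>R w \<and> (\<Sum>x\<in>UNIV. u $ x * w $ x) = 1"
    obtain t where t: "w = t *\<^sub>R v"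
      using irreducible_eigenvector_unique[OF nonneg irr, of v ?r w] v w \<open>0 < ?r\<close> by auto
    have "(\<Sum>x\<in>UNIV. u $ x * w $ x) = t * (\<Sum>x\<in>UNIV. u $ x * v $ x)"
      by (simp add: t sum_distrib_left mult_ac)
    then show "w = v" using w t v(3) by simp
  qed (use v in auto)
  then show "0 < perron_right A $ x" "A *v perron_right A = ?r *\<^sub>R perron_right A"
    using v by auto
qed

section \<open>Uniform bounds on Perron eigenvectors\<close>

text \<open>Finiteness of \<open>T\<close> makes the bounds uniform over all pairs. The length
  \<open>n\<close> still depends on the pair, since periodicity may rule out a common one.\<close>

lemma irreducible_on_uniform:
  fixes A :: "real ^ 's::finite ^ 's"
  assumes "irreducible_on T A"
  obtains c N where "0 < c" "c \<le> 1"
    "\<And>x y. x \<in> T \<Longrightarrow> y \<in> T \<Longrightarrow> \<exists>n. 1 \<le> n \<and> n \<le> N \<and> c \<le> submatrix_power T A n x y"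
proof -
  have "\<forall>p\<in>T \<times> T. \<exists>n. 1 \<le> n \<and> 0 < submatrix_power T A n (fst p) (snd p)"
    using assms by (auto simp: irreducible_on_def)
  then obtain n where
    n: "\<And>p. p \<in> T \<times> T \<Longrightarrow> 1 \<le> n p \<and> 0 < submatrix_power T A (n p) (fst p) (snd p)"
    by metis
  \<comment> \<open>Inserting 1 ensures \<open>c \<le> 1\<close> and keeps the set nonempty when
    \<open>T\<close> is empty.\<close>
  let ?C = "insert 1 ((\<lambda>p. submatrix_power T A (n p) (fst p) (snd p)) ` (T \<times> T))"
  show ?thesis
  proof
    show "0 < Min ?C" using n by (subst Min_gr_iff) auto
    show "Min ?C \<le> 1" by (rule Min_le) auto
    fix x y assume "x \<in> T" "y \<in> T"
    then have "(x, y) \<in> T \<times> T" by simp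
    moreover from this have "n (x, y) \<le> Max (n ` (T \<times> T))"
      and "Min ?C \<le> submatrix_power T A (n (x, y)) x y"
      by (force intro: Max_ge, force intro: Min_le)
    ultimately show "\<exists>k. 1 \<le> k \<and> k \<le> Max (n ` (T \<times> T)) \<and> Min ?C \<le> submatrix_power T A k x y"
      using n by blast
  qed
qed

text \<open>The point is that \<open>C\<close> is chosen before \<theta>, \<open>v\<close> and
  \<open>r\<close>. Ratios of entries are invariant under scaling, so any positive eigenvector may
  stand for the normalised one.\<close>

lemma perron_ratio_bounded:
  fixes P :: "real ^ 's::finite ^ 's" and g :: "'s \<Rightarrow> real"
  assumes stoch: "stochastic P" and irr: "irreducible_on UNIV P"
    and g: "\<And>x. g x \<le> 0" and S: "S = {x. g x = 0}" "S \<noteq> {}"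
    and irrS: "irreducible_on S P"
    and reach: "\<And>x. x \<notin> S \<Longrightarrow> \<exists>y\<in>S. P $ x $ y > 0"
  obtains C where "\<And>\<theta> v r x y. \<lbrakk>0 \<le> \<theta>; \<And>x. 0 < v $ x; 0 < r;
    tilted P g \<theta> *v v = r *\<^sub>R v\<rbrakk> \<Longrightarrow> v $ x \<le> C * v $ y"
proof -
  have P: "0 \<le> P $ x $ y" "(\<Sum>y\<in>UNIV. P $ x $ y) = 1" for x y
    using stoch by (auto simp: stochastic_def)
  obtain c N where c: "0 < c" "c \<le> 1" and
    cS: "\<And>x y. x \<in> S \<Longrightarrow> y \<in> S \<Longrightarrow> \<exists>n. 1 \<le> n \<and> n \<le> N \<and> c \<le> submatrix_power S P n x y"
    using irreducible_on_uniform[OF irrS] by blast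
  obtain c' N' where c': "0 < c'" "c' \<le> 1" and
    cU: "\<And>x y. \<exists>n. 1 \<le> n \<and> n \<le> N' \<and> c' \<le> submatrix_power UNIV P n x y"
    using irreducible_on_uniform[OF irr] UNIV_I by metis
  obtain s where s: "\<And>x. x \<notin> S \<Longrightarrow> s x \<in> S \<and> 0 < P $ x $ s x"
    using reach by metis
  \<comment> \<open>A lower bound for the probability of entering \<open>S\<close> in one step from
    outside.\<close>
  define p where "p = Min (insert 1 ((\<lambda>x. P $ x $ s x) ` (- S)))"
  have p: "0 < p" "p \<le> 1" "\<And>x. x \<notin> S \<Longrightarrow> p \<le> P $ x $ s x"
    unfolding p_def using s by (auto simp: Min_gr_iff intro: Min_le)
  \<comment> \<open>A gap between the maximum 0 of \<open>g\<close> and its values off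
    \<open>S\<close>.\<close>
  define e where "e = Min (insert 1 ((\<lambda>x. - g x) ` (- S)))"
  have gS: "g x < 0" if "x \<notin> S" for x using that g[of x] by (auto simp: S(1) less_le)
  then have e: "0 < e" "\<And>x. x \<notin> S \<Longrightarrow> g x \<le> - e"
  proof -
    show "0 < e" unfolding e_def using gS by (auto simp: Min_gr_iff)
    show "g x \<le> - e" if "x \<notin> S" for x
    proof -
      have "e \<le> - g x" unfolding e_def using that by (intro Min_le) auto
      then show ?thesis by simp
    qed
  qed
  \<comment> \<open>Chosen so that \<open>exp (- \<theta>0 * e) = c / 2\<close>, half of the lower
    bound \<open>c\<close> for \<open>r\<close> shown below.\<close>
  define \<theta>0 where "\<theta>0 = ln (2 / c) / e"
  have \<theta>0: "0 \<le> \<theta>0" using c e by (simp add: \<theta>0_def)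
  define m where "m = Min (range g)"
  have m: "m \<le> g x" for x unfolding m_def by (intro Min_le) auto
  \<comment> \<open>A lower bound for every weight \<open>exp (\<theta> * g y)\<close> with
    \<open>0 \<le> \<theta> \<le> \<theta>0\<close>.\<close>
  define d where "d = exp (\<theta>0 * m)"
  have "m \<le> 0" using m g order_trans by blast
  then have d: "0 < d" "d \<le> 1" using \<theta>0 by (auto simp: d_def mult_nonneg_nonpos)
  \<comment> \<open>The first entry serves \<open>\<theta> \<le> \<theta>0\<close>, the second
    larger \<theta>.\<close>
  define C where "C = max (1 / (d ^ N' * c')) (2 / (c * (p * c)))"
  have "v $ x \<le> C * v $ y"
    if \<theta>: "0 \<le> \<theta>" and v: "\<And>x. 0 < v $ x" and "0 < r" and ev: "tilted P g \<theta> *v v = r *\<^sub>R v"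
    for \<theta> r :: real and v :: "real ^ 's" and x y
  proof -
    let ?A = "tilted P g \<theta>"
    have A: "0 \<le> ?A $ x $ y" "?A $ x $ y \<le> P $ x $ y" for x y
      using P(1) \<theta> g by (auto simp: tilted_def mult_nonneg_nonpos intro!: mult_left_le)
    have evx: "r * v $ x = (\<Sum>y\<in>UNIV. ?A $ x $ y * v $ y)" for x
      using arg_cong[OF ev, of "\<lambda>w. w $ x"] by (simp add: matrix_vector_mult_def)
    have pow_le: "submatrix_power T ?A n x y * v $ y \<le> r ^ n * v $ x" if "y \<in> T" for T n x y
      using A(1) v \<open>0 < r\<close> ev that
      by (intro submatrix_power_le_of_supereigenvector) (auto simp: less_imp_le)
    obtain z where z: "\<And>y. v $ y \<le> v $ z"
    proof -
      have "Max (range (($) v)) \<in> range (($) v)" by (rule Max_in) auto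
      then obtain z where "Max (range (($) v)) = v $ z" by (rule imageE)
      moreover have "v $ y \<le> Max (range (($) v))" for y by (rule Max_ge) auto
      ultimately show ?thesis using that[of z] by simp
    qed
    \<comment> \<open>Read the eigenvalue equation at the maximum \<open>z\<close> of
      \<open>v\<close>: the row of \<open>?A\<close> is dominated by a probability vector.\<close>
    have "r \<le> 1"
    proof -
      have "r * v $ z \<le> (\<Sum>y\<in>UNIV. P $ z $ y * v $ z)"
        unfolding evx using A z v P by (intro sum_mono mult_mono) (auto simp: less_imp_le)
      also have "\<dots> = v $ z" by (simp add: sum_distrib_right[symmetric] P)
      finally show ?thesis using v[of z] by simp
    qed
    have pow_le_v: "submatrix_power T ?A n x y * v $ y \<le> v $ x" if "y \<in> T" for T n x y
    proof -
      have "r ^ n \<le> 1" using \<open>0 < r\<close> \<open>r \<le> 1\<close> by (simp add: power_le_one)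
      then have "r ^ n * v $ x \<le> 1 * v $ x" using v[of x] by (intro mult_right_mono) auto
      then show ?thesis using pow_le[OF that, of n x] by simp
    qed
    \<comment> \<open>Columns in \<open>S\<close> carry the weight \<open>exp 0 = 1\<close>, so this
      bound is independent of \<theta>.\<close>
    have powS: "submatrix_power S P n x y \<le> submatrix_power S ?A n x y" for n x y
      using submatrix_power_mono[of 1 P S ?A n x y] P by (auto simp: S(1) tilted_def)
    \<comment> \<open>A closed path inside \<open>S\<close> gives \<open>c \<le> r ^ n\<close>; then
      \<open>r \<le> 1\<close> and \<open>n \<ge> 1\<close> give
      \<open>r ^ n \<le> r\<close>.\<close>
    have "c \<le> r"
    proof -
      obtain x where x: "x \<in> S" using S by blast
      then obtain n where n: "1 \<le> n" "c \<le> submatrix_power S P n x x" using cS by blast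
      then have "c * v $ x \<le> submatrix_power S ?A n x x * v $ x"
        using powS[of n x x] v[of x] by (intro mult_right_mono) auto
      also have "\<dots> \<le> r ^ n * v $ x" using pow_le x by blast
      finally have "c \<le> r ^ n" using v[of x] by simp
      also have "\<dots> \<le> r" using power_decreasing[of 1 n r] n \<open>0 < r\<close> \<open>r \<le> 1\<close> by simp
      finally show ?thesis .
    qed
    have vS: "c * v $ y \<le> v $ x" if xy: "x \<in> S" "y \<in> S" for x y
    proof -
      obtain n where "c \<le> submatrix_power S P n x y" using cS xy by blast
      then have "c * v $ y \<le> submatrix_power S ?A n x y * v $ y"
        using powS[of n x y] v[of y] by (intro mult_right_mono) auto
      then show ?thesis using pow_le_v[of y S n x] xy by simp
    qed
    \<comment> \<open>From outside \<open>S\<close>, first step to \<open>s x\<close> at cost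
      \<open>p\<close>, then move inside \<open>S\<close> at cost \<open>c\<close>.\<close>
    have low: "(p * c) * v $ y \<le> v $ x" if y: "y \<in> S" for x y
    proof (cases "x \<in> S")
      case True
      have "p * (c * v $ y) \<le> 1 * (c * v $ y)"
        using p c v[of y] by (intro mult_right_mono) auto
      then show ?thesis using vS[OF True y] by simp
    next
      case False
      have "p * (c * v $ y) \<le> P $ x $ s x * v $ s x"
        using p s[OF False] c v vS[of "s x" y] False y P
        by (intro mult_mono) (auto simp: less_imp_le)
      also have "\<dots> = ?A $ x $ s x * v $ s x" using s[OF False] by (simp add: tilted_def S(1))
      also have "\<dots> \<le> (\<Sum>y\<in>UNIV. ?A $ x $ y * v $ y)"
        using A v by (intro member_le_sum) (auto simp: less_imp_le)
      also have "\<dots> = r * v $ x" by (simp add: evx)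
      also have "\<dots> \<le> 1 * v $ x" using \<open>r \<le> 1\<close> v[of x] by (intro mult_right_mono) auto
      finally show ?thesis by (simp add: mult_ac)
    qed
    show ?thesis
    proof (cases "\<theta> \<le> \<theta>0")
      case True
      obtain n where n: "n \<le> N'" "c' \<le> submatrix_power UNIV P n y x" using cU by blast
      have "d * P $ x $ y \<le> ?A $ x $ y" for x y
      proof -
        have "\<theta>0 * m \<le> \<theta> * m" using True \<open>m \<le> 0\<close> by (rule mult_right_mono_neg)
        also have "\<dots> \<le> \<theta> * g y" using m \<theta> by (rule mult_left_mono)
        finally have "d \<le> exp (\<theta> * g y)" by (simp add: d_def)
        from mult_right_mono[OF this P(1)[of x y]] show ?thesis
          by (simp add: tilted_def mult.commute)
      qed
      then have "d ^ n * submatrix_power UNIV P n y x \<le> submatrix_power UNIV ?A n y x"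
        using submatrix_power_mono[of d P UNIV ?A n y x] d P by auto
      moreover have "d ^ N' * c' \<le> d ^ n * submatrix_power UNIV P n y x"
        using d c' n by (intro mult_mono power_decreasing) auto
      ultimately have "d ^ N' * c' * v $ x \<le> submatrix_power UNIV ?A n y x * v $ x"
        using v[of x] by (intro mult_right_mono) auto
      then have "d ^ N' * c' * v $ x \<le> v $ y" using pow_le_v[of x UNIV n y] by simp
      then have "v $ x \<le> 1 / (d ^ N' * c') * v $ y" using d c' by (simp add: field_simps)
      also have "\<dots> \<le> C * v $ y" using v[of y] by (intro mult_right_mono) (auto simp: C_def)
      finally show ?thesis .
    next
      case False
      \<comment> \<open>The mass sent outside \<^term>\<open>S\<close> is damped below half the eigenvalue, so the
        maximum of \<^term>\<open>v\<close> is controlled by its values on \<^term>\<open>S\<close>.\<close>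
      have damp: "exp (\<theta> * g y) \<le> c / 2" if "y \<notin> S" for y
      proof -
        have "\<theta> * g y \<le> \<theta> * (- e)" using e(2)[OF that] \<theta> by (rule mult_left_mono)
        also have "\<dots> \<le> \<theta>0 * (- e)" using False e(1) by (intro mult_right_mono_neg) auto
        also have "\<dots> = ln (c / 2)" using e(1) c by (simp add: \<theta>0_def ln_div)
        finally have "exp (\<theta> * g y) \<le> exp (ln (c / 2))" by simp
        then show ?thesis using c by simp
      qed
      \<comment> \<open>\<open>low\<close> read as an upper bound: every value of \<open>v\<close>
        on \<open>S\<close> is controlled by an arbitrary entry \<open>v $ y\<close>.\<close>
      have M: "v $ t \<le> v $ y / (p * c)" if "t \<in> S" for t
        using low[OF that, of y] p c by (simp add: field_simps)
      let ?M = "v $ y / (p * c)"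
      have M0: "0 \<le> ?M" using v[of y] p c by simp
      \<comment> \<open>Each term is bounded by the sum of the bounds on and off \<open>S\<close>,
        so that the row sum 1 of \<open>P\<close> can be used without splitting the sum.\<close>
      have "r * v $ z \<le> (\<Sum>t\<in>UNIV. P $ z $ t * (?M + c / 2 * v $ z))"
        unfolding evx
      proof (rule sum_mono)
        fix t
        have "exp (\<theta> * g t) * v $ t \<le> ?M + c / 2 * v $ z"
        proof (cases "t \<in> S")
          case True
          have "0 \<le> c / 2 * v $ z" using c v[of z] by simp
          moreover have "g t = 0" using True S(1) by simp
          ultimately show ?thesis using M[OF True] by simp
        next
          case False
          have "exp (\<theta> * g t) * v $ t \<le> c / 2 * v $ z"
            using damp[OF False] z[of t] v[of t] c by (intro mult_mono) auto
          then show ?thesis using M0 by simp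
        qed
        then show "?A $ z $ t * v $ t \<le> P $ z $ t * (?M + c / 2 * v $ z)"
          using mult_left_mono P(1)[of z t] by (simp add: tilted_def mult.assoc)
      qed
      also have "\<dots> = ?M + c / 2 * v $ z" by (simp only: sum_distrib_right[symmetric] P mult_1)
      finally have "r * v $ z \<le> ?M + c / 2 * v $ z" .
      \<comment> \<open>Half of the left side now absorbs the damped term
        \<open>c / 2 * v $ z\<close>.\<close>
      moreover have "c * v $ z \<le> r * v $ z" using \<open>c \<le> r\<close> v[of z] by (intro mult_right_mono) auto
      ultimately have "c * v $ z \<le> 2 * ?M" by simp
      then have "v $ z \<le> 2 * ?M / c" using c by (simp only: pos_le_divide_eq mult.commute)
      also have "\<dots> = 2 / (c * (p * c)) * v $ y" by simp
      also have "\<dots> \<le> C * v $ y" using v[of y] by (intro mult_right_mono) (auto simp: C_def)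
      finally show ?thesis using z[of x] by simp
    qed
  qed
  then show ?thesis using that by blast
qed

section \<open>Tilted matrices and finiteness of the eigenvector ratio\<close>

lemma tilted_nonneg:
  "stochastic P \<Longrightarrow> 0 \<le> tilted P f \<theta> $ x $ y"
  by (simp add: tilted_def stochastic_def)

text \<open>The finitely many weights have a positive minimum \<open>c\<close>, so a path of length
  \<open>n\<close> loses at most the factor \<open>c ^ n\<close>.\<close>

lemma tilted_irreducible:
  fixes P :: "real ^ 's::finite ^ 's"
  assumes "stochastic P" "irreducible_on UNIV P"
  shows "irreducible_on UNIV (tilted P f \<theta>)"
  unfolding irreducible_on_def
proof (intro ballI)
  fix x y
  define c where "c = Min (range (\<lambda>y. exp (\<theta> * f y)))"
  have "0 < c" by (auto simp: c_def Min_gr_iff)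
  have c: "c \<le> exp (\<theta> * f y)" for y unfolding c_def by (intro Min_le) auto
  have P: "0 \<le> P $ x $ y" for x y using assms(1) by (simp add: stochastic_def)
  obtain n where n: "n \<ge> 1" "0 < submatrix_power UNIV P n x y"
    using assms(2) by (auto simp: irreducible_on_def)
  have "c * P $ x $ y \<le> tilted P f \<theta> $ x $ y" for x y
    using mult_right_mono[OF c[of y] P[of x y]] by (simp add: tilted_def mult.commute)
  then have "c ^ n * submatrix_power UNIV P n x y \<le> submatrix_power UNIV (tilted P f \<theta>) n x y"
    using submatrix_power_mono[of c P] P \<open>0 < c\<close> by fastforce
  moreover have "0 < c ^ n * submatrix_power UNIV P n x y" using n \<open>0 < c\<close> by simp
  ultimately show "\<exists>n\<ge>1. 0 < submatrix_power UNIV (tilted P f \<theta>) n x y"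
    using n(1) less_le_trans by blast
qed

text \<open>Turns the extended-real supremum into a real constant \<open>k\<close> that also serves
  as a ratio bound for all \<theta> \<ge> 0.\<close>

lemma K_u_finite:
  fixes P :: "real ^ 's::finite ^ 's" and f :: "'s \<Rightarrow> real"
  assumes stoch: "stochastic P" and irr: "irreducible_on UNIV P"
    and S: "S = {x. f x = Max (range f)}"
    and irrS: "irreducible_on S P"
    and reach: "\<And>x. x \<notin> S \<Longrightarrow> \<exists>y\<in>S. P $ x $ y > 0"
  obtains k where "K_u P f = ereal k" "1 \<le> k"
    "\<And>\<theta> x y. 0 \<le> \<theta> \<Longrightarrow>
      perron_right (tilted P f \<theta>) $ x \<le> k * perron_right (tilted P f \<theta>) $ y"
proof -
  let ?v = "\<lambda>\<theta>. perron_right (tilted P f \<theta>)" and ?b = "Max (range f)"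
  let ?g = "\<lambda>x. f x - ?b"
  note pf = perron_right_eigenvector[OF tilted_nonneg[OF stoch] tilted_irreducible[OF stoch irr], of f]
  have gle: "?g x \<le> 0" for x by simp
  have Sg: "S = {x. ?g x = 0}" using S by simp
  have "?b \<in> range f" by (rule Max_in) auto
  then obtain x where "?b = f x" by blast
  then have Sne: "S \<noteq> {}" using S by (metis (mono_tags) empty_iff mem_Collect_eq)
  obtain C where C: "\<And>\<theta> v r x y. \<lbrakk>0 \<le> \<theta>; \<And>x. 0 < v $ x; 0 < r;
      tilted P ?g \<theta> *v v = r *\<^sub>R v\<rbrakk> \<Longrightarrow> v $ x \<le> C * v $ y"
    using perron_ratio_bounded[of P ?g S] stoch irr gle Sg Sne irrS reach by metis
  have ratio: "?v \<theta> $ x / ?v \<theta> $ y \<le> C" if "0 \<le> \<theta>" for \<theta> x y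
  proof -
    \<comment> \<open>Shifting \<open>f\<close> by a constant multiplies the matrix by a scalar:
      eigenvectors persist and only the eigenvalue is rescaled.\<close>
    have "tilted P ?g \<theta> = exp (- \<theta> * ?b) *\<^sub>R tilted P f \<theta>"
      by (simp add: tilted_def vec_eq_iff right_diff_distrib exp_diff exp_minus divide_inverse)
    then have "tilted P ?g \<theta> *v ?v \<theta> = (exp (- \<theta> * ?b) * spectral_radius (tilted P f \<theta>)) *\<^sub>R ?v \<theta>"
      using pf(3)[of \<theta>] by (simp add: scaleR_matrix_vector_assoc[symmetric])
    then have "?v \<theta> $ x \<le> C * ?v \<theta> $ y"
      using C[OF that pf(2) mult_pos_pos[OF exp_gt_zero pf(1)]] by blast
    then show ?thesis using pf(2)[of \<theta> y] by (simp add: field_simps)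
  qed
  have upper: "K_u P f \<le> ereal C"
    unfolding K_u_def by (intro SUP_least) (simp add: ratio)
  have le: "ereal (?v \<theta> $ x / ?v \<theta> $ y) \<le> K_u P f" if "0 \<le> \<theta>" for \<theta> x y
    unfolding K_u_def by (rule SUP_upper2[of \<theta>], use that in simp)
      (intro SUP_upper2[of x] SUP_upper2[of y]; simp)
  \<comment> \<open>The ratio with \<open>x = y\<close> is 1; \<open>undefined\<close> is just some
    state.\<close>
  have one: "1 \<le> K_u P f"
    using le[of 0 undefined undefined] pf(2)[of 0 undefined] by (simp add: one_ereal_def)
  obtain k where k: "K_u P f = ereal k" using upper one by (cases "K_u P f") auto
  show ?thesis
  proof
    show "1 \<le> k" using one k by simp
    show "?v \<theta> $ x \<le> k * ?v \<theta> $ y" if "0 \<le> \<theta>" for \<theta> x y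
      using le[OF that, of x y] k pf(2)[of \<theta> y] by (simp add: field_simps)
  qed (fact k)
qed

section \<open>The exponential martingale\<close>

context markov_chain
begin

lemma measurable_path_event [measurable]:
  "{\<omega> \<in> space M. X k \<omega> = y} \<in> sets M"
  using measurable_X[of k] by measurable

lemma path_event: "{\<omega> \<in> space M. \<forall>i\<le>n. X i \<omega> = h i} \<in> sets M"
  by measurable

text \<open>The Markov property in product form, which also covers paths of probability zero, where
  both sides vanish.\<close>

lemma prob_path_step:
  "prob {\<omega> \<in> space M. (\<forall>i\<le>n. X i \<omega> = h i) \<and> X (Suc n) \<omega> = y} =
    prob {\<omega> \<in> space M. \<forall>i\<le>n. X i \<omega> = h i} * P $ h n $ y"
proof (cases "prob {\<omega> \<in> space M. \<forall>i\<le>n. X i \<omega> = h i} = 0")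
  case True
  have "prob {\<omega> \<in> space M. (\<forall>i\<le>n. X i \<omega> = h i) \<and> X (Suc n) \<omega> = y} \<le>
      prob {\<omega> \<in> space M. \<forall>i\<le>n. X i \<omega> = h i}"
    by (intro finite_measure_mono path_event) auto
  then show ?thesis using True by (simp add: measure_le_0_iff)
next
  case False
  then have pos: "0 < prob {\<omega> \<in> space M. \<forall>i\<le>n. X i \<omega> = h i}" by (simp add: less_le)
  show ?thesis
    using transition[OF pos, of y] False by (simp add: cond_prob_def field_simps conj_commute)
qed

text \<open>Averages out the last step given the past: \<open>\<phi> (X (Suc n))\<close> is replaced
  by its mean under row \<open>X n\<close> of \<open>P\<close>. Since \<open>F\<close> sees only
  times up to \<open>n\<close>, everything reduces to a finite sum over paths.\<close>

lemma expectation_step: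
  fixes F :: "(nat \<Rightarrow> 's) \<Rightarrow> real" and \<phi> :: "'s \<Rightarrow> real"
  assumes F: "\<And>g h. (\<And>i. i \<le> n \<Longrightarrow> g i = h i) \<Longrightarrow> F g = F h"
  shows "expectation (\<lambda>\<omega>. F (\<lambda>i. X i \<omega>) * \<phi> (X (Suc n) \<omega>)) =
    expectation (\<lambda>\<omega>. F (\<lambda>i. X i \<omega>) * (\<Sum>y\<in>UNIV. P $ X n \<omega> $ y * \<phi> y))"
proof -
  let ?H = "{..n} \<rightarrow>\<^sub>E (UNIV :: 's set)"
  let ?E = "\<lambda>h. {\<omega> \<in> space M. \<forall>i\<le>n. X i \<omega> = h i}"
  let ?E' = "\<lambda>h y. {\<omega> \<in> space M. (\<forall>i\<le>n. X i \<omega> = h i) \<and> X (Suc n) \<omega> = y}"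
  have fin: "finite ?H" by (intro finite_PiE) auto
  have E': "?E' h y \<in> sets M" for h y by measurable
  have ind: "integrable M (\<lambda>\<omega>. c * indicator A \<omega>)"
      "expectation (\<lambda>\<omega>. c * indicator A \<omega>) = c * prob A"
    if "A \<in> sets M" for A and c :: real
    using that by (auto simp: less_top[symmetric])
  \<comment> \<open>Exactly one path indicator is nonzero at \<omega>, namely that of the observed
    path restricted to \<open>{..n}\<close>.\<close>
  have split: "G (\<lambda>i. X i \<omega>) = (\<Sum>h\<in>?H. G h * indicator (?E h) \<omega>)"
    if \<omega>: "\<omega> \<in> space M" and G: "\<And>g h. (\<And>i. i \<le> n \<Longrightarrow> g i = h i) \<Longrightarrow> G g = G h"
    for G :: "(nat \<Rightarrow> 's) \<Rightarrow> real" and \<omega>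
  proof -
    let ?p = "restrict (\<lambda>i. X i \<omega>) {..n}"
    have "(\<Sum>h\<in>?H. G h * indicator (?E h) \<omega>) = (\<Sum>h\<in>?H. if h = ?p then G h else 0)"
    proof (rule sum.cong[OF refl])
      fix h assume h: "h \<in> ?H"
      have "\<omega> \<in> ?E h \<longleftrightarrow> h = ?p"
        using \<omega> PiE_ext[OF h, of ?p] by auto
      then show "G h * indicator (?E h) \<omega> = (if h = ?p then G h else 0)"
        by (simp add: indicator_def)
    qed
    also have "\<dots> = G ?p" using fin by (simp add: sum.delta)
    also have "\<dots> = G (\<lambda>i. X i \<omega>)" by (rule G) simp
    finally show ?thesis by simp
  qed
  have "expectation (\<lambda>\<omega>. F (\<lambda>i. X i \<omega>) * \<phi> (X (Suc n) \<omega>)) =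
      expectation (\<lambda>\<omega>. \<Sum>h\<in>?H. \<Sum>y\<in>UNIV. F h * \<phi> y * indicator (?E' h y) \<omega>)"
  proof (rule Bochner_Integration.integral_cong[OF refl])
    fix \<omega> assume \<omega>: "\<omega> \<in> space M"
    have "F h * indicator (?E h) \<omega> * \<phi> (X (Suc n) \<omega>) =
        (\<Sum>y\<in>UNIV. F h * \<phi> y * indicator (?E' h y) \<omega>)" for h
    proof -
      have "(\<Sum>y\<in>UNIV. F h * \<phi> y * indicator (?E' h y) \<omega>) =
          (\<Sum>y\<in>UNIV. if y = X (Suc n) \<omega> then F h * \<phi> y * indicator (?E h) \<omega> else 0)"
        by (intro sum.cong) (auto simp: indicator_def)
      then show ?thesis by (simp add: sum.delta mult_ac)
    qed
    then show "F (\<lambda>i. X i \<omega>) * \<phi> (X (Suc n) \<omega>) =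
        (\<Sum>h\<in>?H. \<Sum>y\<in>UNIV. F h * \<phi> y * indicator (?E' h y) \<omega>)"
      by (subst split[OF \<omega> F]) (auto simp: sum_distrib_right)
  qed
  also have "\<dots> = (\<Sum>h\<in>?H. \<Sum>y\<in>UNIV. F h * \<phi> y * prob (?E' h y))"
    by (simp only: Bochner_Integration.integral_sum Bochner_Integration.integrable_sum ind E')
  also have "\<dots> = (\<Sum>h\<in>?H. F h * (\<Sum>y\<in>UNIV. P $ h n $ y * \<phi> y) * prob (?E h))"
    by (simp add: prob_path_step sum_distrib_left sum_distrib_right mult_ac)
  also have "\<dots> = expectation (\<lambda>\<omega>. \<Sum>h\<in>?H. F h * (\<Sum>y\<in>UNIV. P $ h n $ y * \<phi> y) * indicator (?E h) \<omega>)"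
    by (simp only: Bochner_Integration.integral_sum ind path_event)
  also have "\<dots> = expectation (\<lambda>\<omega>. F (\<lambda>i. X i \<omega>) * (\<Sum>y\<in>UNIV. P $ X n \<omega> $ y * \<phi> y))"
  proof (rule Bochner_Integration.integral_cong[OF refl])
    fix \<omega> assume \<omega>: "\<omega> \<in> space M"
    have "F g * (\<Sum>y\<in>UNIV. P $ g n $ y * \<phi> y) = F h * (\<Sum>y\<in>UNIV. P $ h n $ y * \<phi> y)"
      if "\<And>i. i \<le> n \<Longrightarrow> g i = h i" for g h
      using F[OF that] that[of n] by simp
    from split[OF \<omega>, of "\<lambda>h. F h * (\<Sum>y\<in>UNIV. P $ h n $ y * \<phi> y)", OF this]
    show "(\<Sum>h\<in>?H. F h * (\<Sum>y\<in>UNIV. P $ h n $ y * \<phi> y) * indicator (?E h) \<omega>) =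
        F (\<lambda>i. X i \<omega>) * (\<Sum>y\<in>UNIV. P $ X n \<omega> $ y * \<phi> y)" by simp
  qed
  finally show ?thesis .
qed

text \<open>The constant expectation of the martingale, by induction with
  \<open>exp (\<theta> * f y) * v $ y\<close> averaged over the last step. The tilt acts on columns,
  which matches a sum that starts at time 1.\<close>

lemma expectation_eigenvector:
  fixes f :: "'s \<Rightarrow> real"
  assumes "tilted P f \<theta> *v v = r *\<^sub>R v"
  shows "expectation (\<lambda>\<omega>. exp (\<theta> * (\<Sum>k=1..n. f (X k \<omega>))) * v $ X n \<omega>) =
    r ^ n * expectation (\<lambda>\<omega>. v $ X 0 \<omega>)"
proof (induction n)
  case (Suc n)
  let ?F = "\<lambda>g. exp (\<theta> * (\<Sum>k=1..n. f (g k)))"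
  have eig: "(\<Sum>y\<in>UNIV. P $ x $ y * (exp (\<theta> * f y) * v $ y)) = r * v $ x" for x
    using arg_cong[OF assms, of "\<lambda>w. w $ x"]
    by (simp add: matrix_vector_mult_def tilted_def mult.assoc)
  have "expectation (\<lambda>\<omega>. exp (\<theta> * (\<Sum>k=1..Suc n. f (X k \<omega>))) * v $ X (Suc n) \<omega>) =
      expectation (\<lambda>\<omega>. ?F (\<lambda>i. X i \<omega>) * (exp (\<theta> * f (X (Suc n) \<omega>)) * v $ X (Suc n) \<omega>))"
    by (simp add: distrib_left exp_add mult.assoc)
  also have "\<dots> = expectation (\<lambda>\<omega>. ?F (\<lambda>i. X i \<omega>) *
      (\<Sum>y\<in>UNIV. P $ X n \<omega> $ y * (exp (\<theta> * f y) * v $ y)))"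
    by (rule expectation_step[of n ?F "\<lambda>y. exp (\<theta> * f y) * v $ y"]) 
      (auto intro!: arg_cong[where f = exp] arg_cong[where f = "(*) \<theta>"] sum.cong arg_cong[where f = f])
  also have "\<dots> = r * expectation (\<lambda>\<omega>. ?F (\<lambda>i. X i \<omega>) * v $ X n \<omega>)"
    unfolding eig by (simp add: mult.left_commute)
  finally show ?case unfolding Suc.IH by (simp only: power_Suc mult.assoc)
qed simp

text \<open>In the martingale identity, \<open>v $ X n \<omega>\<close> is compared directly with
  the mean of \<open>v $ X 0\<close>, so each direction costs one factor \<open>k\<close>;
  logarithms divided by \<open>n\<close> give the claim.\<close>

lemma scaled_cgf_bound:
  fixes f :: "'s \<Rightarrow> real"
  assumes ev: "tilted P f \<theta> *v v = r *\<^sub>R v" and v: "\<And>x. 0 < v $ x" and "0 < r"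
    and ratio: "\<And>x y. v $ x \<le> k * v $ y" and "1 \<le> k" and "n \<ge> 1"
  shows "\<bar>scaled_cgf M X f n \<theta> - ln r\<bar> \<le> ln k / real n"
proof -
  let ?Z = "\<lambda>\<omega>. exp (\<theta> * (\<Sum>k=1..n. f (X k \<omega>)))"
  have X_f: "(\<lambda>\<omega>. g (X i \<omega>)) \<in> borel_measurable M" for g :: "'s \<Rightarrow> real" and i
    by (rule measurable_compose[OF measurable_X]) simp
  have bound: "\<exists>B. \<forall>x. \<bar>g x\<bar> \<le> B" for g :: "'s \<Rightarrow> real"
    by (rule exI[of _ "Max (range (\<lambda>x. \<bar>g x\<bar>))"]) (auto intro: Max_ge)
  have int_v: "integrable M (\<lambda>\<omega>. g (X i \<omega>))" for g :: "'s \<Rightarrow> real" and i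
  proof -
    obtain B where "\<And>x. \<bar>g x\<bar> \<le> B" using bound[of g] by blast
    then show ?thesis using X_f by (intro integrable_const_bound[where B = B]) auto
  qed
  have mZ: "?Z \<in> borel_measurable M"
    using X_f[of f]
    by (intro measurable_compose[OF _ borel_measurable_exp] borel_measurable_times
        borel_measurable_sum) auto
  obtain B where B: "\<And>x. \<bar>f x\<bar> \<le> B" using bound by blast
  have Zle: "\<bar>?Z \<omega>\<bar> \<le> exp (\<bar>\<theta>\<bar> * (real n * B))" for \<omega>
  proof -
    have "\<bar>\<Sum>k=1..n. f (X k \<omega>)\<bar> \<le> (\<Sum>k=1..n. B)"
      using B by (intro order_trans[OF sum_abs] sum_mono) auto
    then have "\<bar>\<theta> * (\<Sum>k=1..n. f (X k \<omega>))\<bar> \<le> \<bar>\<theta>\<bar> * (real n * B)"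
      by (simp add: abs_mult mult_left_mono)
    then show ?thesis by simp
  qed
  have intZ: "integrable M ?Z"
    using mZ Zle by (intro integrable_const_bound[where B = "exp (\<bar>\<theta>\<bar> * (real n * B))"]) auto
  have intZv: "integrable M (\<lambda>\<omega>. ?Z \<omega> * v $ X n \<omega>)"
  proof -
    obtain D where D: "\<And>x. \<bar>v $ x\<bar> \<le> D" using bound[of "($) v"] by blast
    have "norm (?Z \<omega> * v $ X n \<omega>) \<le> exp (\<bar>\<theta>\<bar> * (real n * B)) * D" for \<omega>
      unfolding real_norm_def abs_mult using Zle D by (intro mult_mono) auto
    then show ?thesis
      using mZ X_f[of "($) v" n]
      by (intro integrable_const_bound[where B = "exp (\<bar>\<theta>\<bar> * (real n * B)) * D"]) auto
  qed
  let ?E = "expectation ?Z" and ?V = "expectation (\<lambda>\<omega>. v $ X 0 \<omega>)"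
  have EZv: "expectation (\<lambda>\<omega>. ?Z \<omega> * v $ X n \<omega>) = r ^ n * ?V"
    by (rule expectation_eigenvector[OF ev])
  \<comment> \<open>\<open>?V\<close> is an average of entries of \<open>v\<close>, hence within a
    factor \<open>k\<close> of each entry.\<close>
  have V: "v $ y \<le> k * ?V" "?V \<le> k * v $ y" for y
  proof -
    have "expectation (\<lambda>\<omega>. v $ y) \<le> expectation (\<lambda>\<omega>. k * v $ X 0 \<omega>)"
      using int_v[of "($) v" 0] ratio by (intro integral_mono) auto
    then show "v $ y \<le> k * ?V" by (simp add: prob_space)
    have "?V \<le> expectation (\<lambda>\<omega>. k * v $ y)"
      using int_v[of "($) v" 0] ratio by (intro integral_mono) auto
    then show "?V \<le> k * v $ y" by (simp add: prob_space)
  qed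
  have "0 < k * ?V" using V(1)[of undefined] v[of undefined] by simp
  then have V0: "0 < ?V" using \<open>1 \<le> k\<close> by (simp add: zero_less_mult_iff)
  \<comment> \<open>Both estimates keep the factor \<open>?V\<close>, which cancels against the one
    in \<open>r ^ n * ?V\<close>.\<close>
  have "?V * ?E = expectation (\<lambda>\<omega>. ?Z \<omega> * ?V)" by simp
  also have "\<dots> \<le> expectation (\<lambda>\<omega>. k * (?Z \<omega> * v $ X n \<omega>))"
    using V(2) by (intro integral_mono integrable_mult_right integrable_mult_left intZ intZv)
      (auto simp: mult.left_commute[of k])
  also have "\<dots> = ?V * (k * r ^ n)" using EZv by simp
  finally have up: "?E \<le> k * r ^ n" using V0 by simp
  have "?V * r ^ n = expectation (\<lambda>\<omega>. ?Z \<omega> * v $ X n \<omega>)" using EZv by simp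
  also have "\<dots> \<le> expectation (\<lambda>\<omega>. ?Z \<omega> * (k * ?V))"
    using V(1) by (intro integral_mono integrable_mult_right integrable_mult_left intZ intZv) auto
  also have "\<dots> = ?V * (k * ?E)" by simp
  finally have low: "r ^ n \<le> k * ?E" using V0 by simp
  have "0 < k * ?E" using low \<open>0 < r\<close> by (meson less_le_trans zero_less_power)
  then have E0: "0 < ?E" using \<open>1 \<le> k\<close> by (simp add: zero_less_mult_iff)
  have "ln ?E \<le> ln (k * r ^ n)" using up E0 by (intro ln_mono) auto
  then have 1: "ln ?E \<le> ln k + real n * ln r"
    using \<open>1 \<le> k\<close> \<open>0 < r\<close> by (simp add: ln_mult ln_realpow)
  have "ln (r ^ n) \<le> ln (k * ?E)" using low \<open>0 < r\<close> by (intro ln_mono) auto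
  then have 2: "real n * ln r \<le> ln k + ln ?E"
    using \<open>1 \<le> k\<close> \<open>0 < r\<close> E0 by (simp add: ln_mult ln_realpow)
  have "scaled_cgf M X f n \<theta> - ln r = (ln ?E - real n * ln r) / real n"
    using \<open>n \<ge> 1\<close> by (simp add: scaled_cgf_def field_simps)
  also have "\<bar>\<dots>\<bar> \<le> ln k / real n"
    using 1 2 by (simp add: divide_right_mono)
  finally show ?thesis .
qed

end

section \<open>Combination of both signs of \<theta> and uniform convergence\<close>

theorem theorem3:
  fixes P :: "real ^ 's ^ 's" and f :: "'s::finite \<Rightarrow> real" and q :: "'s pmf"
    and M :: "'w measure" and X :: "nat \<Rightarrow> 'w \<Rightarrow> 's"
    and a b :: real and Sa Sb :: "'s set" and K :: ereal
  assumes "stochastic P"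
    and "irreducible_on UNIV P"
    and "a = Min (range f)"
    and "b = Max (range f)"
    and "Sa = {x. f x = a}"
    and "Sb = {x. f x = b}"
    and "irreducible_on Sb P"
    and "\<And>x. x \<notin> Sb \<Longrightarrow> \<exists>y\<in>Sb. P $ x $ y > 0"
    and "irreducible_on Sa P"
    and "\<And>x. x \<notin> Sa \<Longrightarrow> \<exists>y\<in>Sa. P $ x $ y > 0"
    and "markov_chain M q P X"
    and "K = max (K_u P f) (K_u P (\<lambda>x. - f x))"
  shows "\<bar>K\<bar> \<noteq> \<infinity> \<and>
    (\<forall>n\<ge>1. (SUP \<theta>. ereal \<bar>scaled_cgf M X f n \<theta> - log_spectral_radius P f \<theta>\<bar>)
        \<le> ereal (ln (real_of_ereal K) / real n)) \<and>
    uniform_limit UNIV (\<lambda>n \<theta>. scaled_cgf M X f n \<theta>) (log_spectral_radius P f) sequentially"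
proof -
  interpret markov_chain M q P X by fact
  note pf = perron_right_eigenvector[OF tilted_nonneg[OF assms(1)] tilted_irreducible[OF assms(1,2)]]
  obtain k1 where k1: "K_u P f = ereal k1" "1 \<le> k1"
    "\<And>\<theta> x y. 0 \<le> \<theta> \<Longrightarrow>
      perron_right (tilted P f \<theta>) $ x \<le> k1 * perron_right (tilted P f \<theta>) $ y"
    using K_u_finite[of P Sb f] assms by blast
  have "Min (range f) \<in> range f" by (rule Min_in) auto
  then obtain x0 where x0: "Min (range f) = f x0" by (rule imageE)
  have "f x0 \<le> f x" for x unfolding x0[symmetric] by (rule Min_le) auto
  then have Max_uminus: "Max (range (\<lambda>x. - f x)) = - Min (range f)"
    unfolding x0 by (intro Max_eqI) auto
  \<comment> \<open>The minimisers of \<open>f\<close> are the maximisers of \<open>- f\<close>, so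
    the finiteness result applies to \<open>- f\<close> with \<open>Sa\<close>.\<close>
  have "Sa = {x. - f x = Max (range (\<lambda>x. - f x))}"
    unfolding assms(5,3) Max_uminus by (simp only: neg_equal_iff_equal)
  then obtain k2 where k2: "K_u P (\<lambda>x. - f x) = ereal k2" "1 \<le> k2"
    "\<And>\<theta> x y. 0 \<le> \<theta> \<Longrightarrow>
      perron_right (tilted P (\<lambda>x. - f x) \<theta>) $ x \<le> k2 * perron_right (tilted P (\<lambda>x. - f x) \<theta>) $ y"
    using K_u_finite[of P Sa "\<lambda>x. - f x"] assms by blast
  define k where "k = max k1 k2"
  have K: "K = ereal k" using assms(12) k1 k2 by (simp add: k_def)
  have "1 \<le> k" using k1 by (simp add: k_def)
  have ratio: "perron_right (tilted P f \<theta>) $ x \<le> k * perron_right (tilted P f \<theta>) $ y" for \<theta> x y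
  proof -
    let ?v = "perron_right (tilted P f \<theta>)"
    have "?v $ x \<le> k1 * ?v $ y \<or> ?v $ x \<le> k2 * ?v $ y"
    proof (cases "0 \<le> \<theta>")
      case False
      \<comment> \<open>Changing both signs leaves the tilted matrix, and thus its Perron vector,
        unchanged.\<close>
      have "tilted P (\<lambda>x. - f x) (- \<theta>) = tilted P f \<theta>" by (simp add: tilted_def)
      then show ?thesis using k2(3)[of "- \<theta>" x y] False by simp
    qed (use k1(3) in simp)
    moreover have "k1 * ?v $ y \<le> k * ?v $ y" "k2 * ?v $ y \<le> k * ?v $ y"
      using pf(2)[of f \<theta> y] by (auto simp: k_def intro!: mult_right_mono)
    ultimately show ?thesis by linarith
  qed
  have bound: "\<bar>scaled_cgf M X f n \<theta> - log_spectral_radius P f \<theta>\<bar> \<le> ln k / real n"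
    if "n \<ge> 1" for n \<theta>
    unfolding log_spectral_radius_def
    using scaled_cgf_bound[OF pf(3) pf(2) pf(1) ratio \<open>1 \<le> k\<close> that] .
  have "uniform_limit UNIV (\<lambda>n \<theta>. scaled_cgf M X f n \<theta>) (log_spectral_radius P f) sequentially"
  proof (rule uniform_limitI)
    fix e :: real assume "0 < e"
    have "(\<lambda>n. ln k / real n) \<longlonglongrightarrow> 0" by (rule lim_const_over_n)
    then have "\<forall>\<^sub>F n in sequentially. ln k / real n < e"
      using \<open>0 < e\<close> by (rule order_tendstoD)
    then show "\<forall>\<^sub>F n in sequentially. \<forall>\<theta>\<in>UNIV.
        dist (scaled_cgf M X f n \<theta>) (log_spectral_radius P f \<theta>) < e"
      \<comment> \<open>The bound is available from \<open>n = 1\<close> on, and it does not involve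
        \<theta>.\<close>
      using eventually_ge_at_top[of 1]
      by eventually_elim (auto simp: dist_real_def intro: le_less_trans[OF bound])
  qed
  moreover have "(SUP \<theta>. ereal \<bar>scaled_cgf M X f n \<theta> - log_spectral_radius P f \<theta>\<bar>)
      \<le> ereal (ln (real_of_ereal K) / real n)" if "n \<ge> 1" for n
    using bound[OF that] K by (intro SUP_least) simp
  ultimately show ?thesis using K by simp
qed

end
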